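(* (a) $\mathsf{EL}_{K,\Box,B}+(\mathrm{D}_B)$ is a sound and complete axiomatization of $\mathcal{L}_{K,\Box,B}$ with respect to the class of all topological subset spaces under e-d semantics for consistent e-d scenarios: for every $\varphi\in\mathcal{L}_{K,\Box,B}$, $\varphi$ is provable in $\mathsf{EL}_{K,\Box,B}+(\mathrm{D}_B)$ if and only if $(\mathcal{X},x,U,V)\models\varphi$ for every topological subset model $\mathcal{X}$ and every consistent e-d scenario $(x,U,V)$ of $\mathcal{X}$. (b) $\mathsf{EL}_{K,\Box,B}+(\mathrm{wF})$ is a sound and complete axiomatization of $\mathcal{L}_{K,\Box,B}$ with respect to the class of all topological subset spaces under e-d semantics for dense e-d scenarios: for every $\varphi\in\mathcal{L}_{K,\Box,B}$, $\varphi$ is provable in $\mathsf{EL}_{K,\Box,B}+(\mathrm{wF})$ if and only if $(\mathcal{X},x,U,V)\models\varphi$ for every topological subset model $\mathcal{X}$ and every dense e-d scenario $(x,U,V)$ of $\mathcal{X}$.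
   Context: Language. Fix a countable set PROP of primitive propositions. $\mathcal{L}_{K,\Box,B}$ is generated by $\varphi ::= p \mid \neg\varphi \mid \varphi\wedge\psi \mid K\varphi\mid\Box\varphi\mid B\varphi$, $p\in$ PROP. The connectives $\vee,\to,\leftrightarrow$ are defined as usual and $\Diamond:=\neg\Box\neg$. The logic $\mathsf{EL}_{K,\Box,B}$ is the Hilbert system (schemes and rules ranging over formulas of $\mathcal{L}_{K,\Box,B}$) consisting of classical propositional logic (with modus ponens) plus: the $\mathsf{S5}$ principles for $K$: $K(\varphi\to\psi)\to(K\varphi\to K\psi)$, $K\varphi\to\varphi$, $K\varphi\to KK\varphi$, $\neg K\varphi\to K\neg K\varphi$, and the rule "from $\vdash\varphi$ infer $\vdash K\varphi$"; the $\mathsf{S4}$ principles for $\Box$: $\Box(\varphi\to\psi)\to(\Box\varphi\to\Box\psi)$, $\Box\varphi\to\varphi$, $\Box\varphi\to\Box\Box\varphi$, and the rule "from $\vdash\varphi$ infer $\vdash\Box\varphi$"; the schemes $(\mathrm{KI})$ $K\varphi\to\Box\varphi$; $(\mathrm{K}_B)$ $B(\varphi\to\psi)\to(B\varphi\to B\psi)$; $(\mathrm{sPI})$ $B\varphi\to KB\varphi$; $(\mathrm{KB})$ $K\varphi\to B\varphi$; $(\mathrm{RB})$ $B\varphi\to B\Box\varphi$. Additional schemes: $(\mathrm{D}_B)$ $B\varphi\to\neg B\neg\varphi$; $(\mathrm{wF})$ $B\varphi\to\Diamond\varphi$. "$\mathsf{EL}_{K,\Box,B}+(\mathrm{A})$"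 denotes the system obtained by adding the scheme $(\mathrm{A})$. E-d semantics. A topological subset model is a triple $\mathcal{X}=(X,\mathcal{T},v)$ where $X$ is a nonempty set, $\mathcal{T}$ is a topology on $X$, and $v:\mathrm{PROP}\to 2^X$. An e-d scenario of $\mathcal{X}$ is a tuple $(x,U,V)$ with $x\in U$, $U,V\in\mathcal{T}$ and $V\subseteq U$ ($x\in V$ is not required). It is consistent if $V\neq\emptyset$, and dense if $U\subseteq\mathit{cl}(V)$. With $[\![\varphi]\!]^{U,V}=\{y\in U : (\mathcal{X},y,U,V)\models\varphi\}$ and $\mathit{int}$, $\mathit{cl}$ the interior and closure in $(X,\mathcal{T})$, truth is defined by: $(\mathcal{X},x,U,V)\models p$ iff $x\in v(p)$; the usual clauses for $\neg$ and $\wedge$; $(\mathcal{X},x,U,V)\models K\varphi$ iff $U=[\![\varphi]\!]^{U,V}$; $(\mathcal{X},x,U,V)\models\Box\varphi$ iff $x\in\mathit{int}([\![\varphi]\!]^{U,V})$; $(\mathcal{X},x,U,V)\models B\varphi$ iff $V\subseteq[\![\varphi]\!]^{U,V}$. *)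

theory Defs
  imports "HOL-Analysis.Abstract_Topology" "HOL-Library.Countable"
begin

text \<open>The type of primitive propositions is a type variable, which the theorem restricts to the
  sort \<open>countable\<close>.\<close>

datatype 'p fm =
    Pro 'p
  | Neg "'p fm"
  | Con "'p fm" "'p fm"
  | Know "'p fm"
  | Box "'p fm"
  | Bel "'p fm"

abbreviation Imp :: "'p fm \<Rightarrow> 'p fm \<Rightarrow> 'p fm" (infixr \<open>\<^bold>\<longrightarrow>\<close> 25) where
  "\<phi> \<^bold>\<longrightarrow> \<psi> \<equiv> Neg (Con \<phi> (Neg \<psi>))"

abbreviation Dia :: "'p fm \<Rightarrow> 'p fm" where
  "Dia \<phi> \<equiv> Neg (Box (Neg \<phi>))"

text \<open>Classical propositional logic is represented by all substitution instances of propositional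
  tautologies: \<open>g\<close> is an arbitrary truth assignment to the formulas that are not of the form
  \<open>Neg \<phi>\<close> or \<open>Con \<phi> \<psi>\<close>.\<close>

fun prop_eval :: "('p fm \<Rightarrow> bool) \<Rightarrow> 'p fm \<Rightarrow> bool" where
  "prop_eval g (Neg \<phi>) \<longleftrightarrow> \<not> prop_eval g \<phi>"
| "prop_eval g (Con \<phi> \<psi>) \<longleftrightarrow> prop_eval g \<phi> \<and> prop_eval g \<psi>"
| "prop_eval g \<phi> \<longleftrightarrow> g \<phi>"

definition tautology :: "'p fm \<Rightarrow> bool" where
  "tautology \<phi> \<longleftrightarrow> (\<forall>g. prop_eval g \<phi>)"

text \<open>\<open>EL A \<phi>\<close> means that \<open>\<phi>\<close> is a theorem of \<open>EL\<close> extended with the members of \<open>A\<close> as axioms.\<close>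

inductive EL :: "'p fm set \<Rightarrow> 'p fm \<Rightarrow> bool" for A where
  Taut: "tautology \<phi> \<Longrightarrow> EL A \<phi>"
| MP: "EL A (\<phi> \<^bold>\<longrightarrow> \<psi>) \<Longrightarrow> EL A \<phi> \<Longrightarrow> EL A \<psi>"
| K_Know: "EL A (Know (\<phi> \<^bold>\<longrightarrow> \<psi>) \<^bold>\<longrightarrow> (Know \<phi> \<^bold>\<longrightarrow> Know \<psi>))"
| T_Know: "EL A (Know \<phi> \<^bold>\<longrightarrow> \<phi>)"
| Four_Know: "EL A (Know \<phi> \<^bold>\<longrightarrow> Know (Know \<phi>))"
| Five_Know: "EL A (Neg (Know \<phi>) \<^bold>\<longrightarrow> Know (Neg (Know \<phi>)))"
| Nec_Know: "EL A \<phi> \<Longrightarrow> EL A (Know \<phi>)"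
| K_Box: "EL A (Box (\<phi> \<^bold>\<longrightarrow> \<psi>) \<^bold>\<longrightarrow> (Box \<phi> \<^bold>\<longrightarrow> Box \<psi>))"
| T_Box: "EL A (Box \<phi> \<^bold>\<longrightarrow> \<phi>)"
| Four_Box: "EL A (Box \<phi> \<^bold>\<longrightarrow> Box (Box \<phi>))"
| Nec_Box: "EL A \<phi> \<Longrightarrow> EL A (Box \<phi>)"
| KI: "EL A (Know \<phi> \<^bold>\<longrightarrow> Box \<phi>)"
| K_Bel: "EL A (Bel (\<phi> \<^bold>\<longrightarrow> \<psi>) \<^bold>\<longrightarrow> (Bel \<phi> \<^bold>\<longrightarrow> Bel \<psi>))"
| sPI: "EL A (Bel \<phi> \<^bold>\<longrightarrow> Know (Bel \<phi>))"
| KB: "EL A (Know \<phi> \<^bold>\<longrightarrow> Bel \<phi>)"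
| RB: "EL A (Bel \<phi> \<^bold>\<longrightarrow> Bel (Box \<phi>))"
| Extra: "\<phi> \<in> A \<Longrightarrow> EL A \<phi>"

definition D_B :: "'p fm set" where
  "D_B = {Bel \<phi> \<^bold>\<longrightarrow> Neg (Bel (Neg \<phi>)) | \<phi>. True}"

definition wF :: "'p fm set" where
  "wF = {Bel \<phi> \<^bold>\<longrightarrow> Dia \<phi> | \<phi>. True}"

text \<open>The carrier set of a model \<open>M\<close> is \<open>topspace (Top M)\<close>, which may be a proper subset of the
  type \<open>'w\<close>.\<close>

record ('w, 'p) model =
  Top :: "'w topology"
  Val :: "'p \<Rightarrow> 'w set"

definition topo_subset_model :: "('w, 'p) model \<Rightarrow> bool" where
  "topo_subset_model M \<longleftrightarrow> topspace (Top M) \<noteq> {} \<and> (\<forall>p. Val M p \<subseteq> topspace (Top M))"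

definition ed_scenario :: "('w, 'p) model \<Rightarrow> 'w \<Rightarrow> 'w set \<Rightarrow> 'w set \<Rightarrow> bool" where
  "ed_scenario M x U V \<longleftrightarrow> x \<in> U \<and> openin (Top M) U \<and> openin (Top M) V \<and> V \<subseteq> U"

definition consistent_scenario :: "('w, 'p) model \<Rightarrow> 'w \<Rightarrow> 'w set \<Rightarrow> 'w set \<Rightarrow> bool" where
  "consistent_scenario M x U V \<longleftrightarrow> ed_scenario M x U V \<and> V \<noteq> {}"

definition dense_scenario :: "('w, 'p) model \<Rightarrow> 'w \<Rightarrow> 'w set \<Rightarrow> 'w set \<Rightarrow> bool" where
  "dense_scenario M x U V \<longleftrightarrow> ed_scenario M x U V \<and> U \<subseteq> Top M closure_of V"

primrec sat :: "('w, 'p) model \<Rightarrow> 'w \<Rightarrow> 'w set \<Rightarrow> 'w set \<Rightarrow> 'p fm \<Rightarrow> bool" where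
  "sat M x U V (Pro p) \<longleftrightarrow> x \<in> Val M p"
| "sat M x U V (Neg \<phi>) \<longleftrightarrow> \<not> sat M x U V \<phi>"
| "sat M x U V (Con \<phi> \<psi>) \<longleftrightarrow> sat M x U V \<phi> \<and> sat M x U V \<psi>"
| "sat M x U V (Know \<phi>) \<longleftrightarrow> U = {y \<in> U. sat M y U V \<phi>}"
| "sat M x U V (Box \<phi>) \<longleftrightarrow> x \<in> Top M interior_of {y \<in> U. sat M y U V \<phi>}"
| "sat M x U V (Bel \<phi>) \<longleftrightarrow> V \<subseteq> {y \<in> U. sat M y U V \<phi>}"

text \<open>A HOL formula cannot quantify over types, so validity is indexed by the type \<open>'w\<close> from
  which the points of the models are drawn. The two-way equivalence with provability is stated for
  \<open>'w = 'p fm set\<close>; since it fails for some small types, an arbitrary \<open>'w\<close> gets soundness only.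
  Together these give: provable iff valid over every type of points.\<close>

definition valid_consistent :: "'w itself \<Rightarrow> 'p fm \<Rightarrow> bool" where
  "valid_consistent _ \<phi> \<longleftrightarrow> (\<forall>(M :: ('w, 'p) model) x U V.
     topo_subset_model M \<longrightarrow> consistent_scenario M x U V \<longrightarrow> sat M x U V \<phi>)"

definition valid_dense :: "'w itself \<Rightarrow> 'p fm \<Rightarrow> bool" where
  "valid_dense _ \<phi> \<longleftrightarrow> (\<forall>(M :: ('w, 'p) model) x U V.
     topo_subset_model M \<longrightarrow> dense_scenario M x U V \<longrightarrow> sat M x U V \<phi>)"

end

theory Submission
  imports Defs
begin

text \<open>Completeness uses one canonical model per maximal consistent set \<open>\<Gamma>\<close>. Its points are the maximal
  consistent sets containing the same formulas \<open>Know \<phi>\<close> as \<open>\<Gamma>\<close>, its open sets are the sets closed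
  under the canonical accessibility relation of \<open>Box\<close>, and it is evaluated with \<open>U\<close> the whole space
  and \<open>V\<close> the set of points containing every \<open>\<phi>\<close> with \<open>Bel \<phi> \<in> \<Gamma>\<close>. The axiom RB makes \<open>V\<close> open,
  the introspection axioms make \<open>V\<close> independent of the point of evaluation, and the axioms \<open>D_B\<close>
  and \<open>wF\<close> make \<open>V\<close> nonempty and dense respectively.\<close>

section \<open>Soundness\<close>

text \<open>Satisfaction commutes with \<open>Neg\<close> and \<open>Con\<close>, so it is itself
  one of the assignments over which \<open>tautology\<close> quantifies.\<close>

lemma prop_eval_sat: "prop_eval (sat M x U V) \<phi> \<longleftrightarrow> sat M x U V \<phi>"
  by (induction \<phi>) auto

text \<open>No modality changes U or V, so the pair stays fixed while the induction varies the point
  over all of U, as both necessitation rules require. Consistency and density of the scenario enter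
  only through the assumption on A.\<close>

lemma soundness:
  assumes "EL A \<phi>" and U: "openin (Top M) U" and V: "openin (Top M) V" and VU: "V \<subseteq> U"
    and A: "\<And>\<psi> y. \<lbrakk>\<psi> \<in> A; y \<in> U\<rbrakk> \<Longrightarrow> sat M y U V \<psi>" and "x \<in> U"
  shows "sat M x U V \<phi>"
  using assms(1,6)
proof (induction arbitrary: x)
  case (Taut \<phi>)
  then show ?case using prop_eval_sat[of M x U V \<phi>] by (simp add: tautology_def)
next
  case (Nec_Know \<phi>)
  then show ?case by auto
next
  case (K_Box \<phi> \<psi>)
  show ?case
    by (auto simp: interior_of_def)
next
  case (T_Box \<phi>)
  show ?case using interior_of_subset[of "Top M" "{y \<in> U. sat M y U V \<phi>}"] by auto
next
  case (Four_Box \<phi>)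
  \<comment> \<open>The interior already lies in U, so the truth set of \<open>Box\<close> \<phi> is
    exactly this interior, and idempotence of the interior finishes the case.\<close>
  have "Top M interior_of {y \<in> U. sat M y U V \<phi>} \<subseteq> U"
    using interior_of_subset[of "Top M" "{y \<in> U. sat M y U V \<phi>}"] by auto
  then have "{y \<in> U. y \<in> Top M interior_of {y \<in> U. sat M y U V \<phi>}} =
      Top M interior_of {y \<in> U. sat M y U V \<phi>}" by auto
  then show ?case by simp
next
  case (Nec_Box \<phi>)
  then have "{y \<in> U. sat M y U V \<phi>} = U" by auto
  with Nec_Box.prems show ?case using U by (simp add: interior_of_openin)
next
  case (KI \<phi>)
  then show ?case using U by (auto simp: interior_of_openin)
next
  case (RB \<phi>)
  \<comment> \<open>V is itself an open subset of the truth set, hence lies in its interior.\<close>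
  show ?case using V VU by (auto simp: interior_of_def)
next
  case (Extra \<phi>)
  then show ?case using A by blast
qed (use VU in auto)

lemma D_B_sound:
  assumes "EL D_B \<phi>" shows "valid_consistent TYPE('w) \<phi>"
  unfolding valid_consistent_def consistent_scenario_def ed_scenario_def
  by (intro allI impI soundness[OF assms]) (fastforce simp: D_B_def)+

lemma wF_sound:
  assumes "EL wF \<phi>" shows "valid_dense TYPE('w) \<phi>"
  unfolding valid_dense_def dense_scenario_def ed_scenario_def
proof (intro allI impI, elim conjE)
  fix M :: "('w, 'a) model" and x U V
  assume M: "x \<in> U" "openin (Top M) U" "openin (Top M) V" "V \<subseteq> U" "U \<subseteq> Top M closure_of V"
  have "sat M y U V (Bel \<psi> \<^bold>\<longrightarrow> Dia \<psi>)" if "y \<in> U" for \<psi> y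
  proof -
    \<comment> \<open>Every open neighbourhood of y meets V, where \<psi> holds if it is believed;
      hence y is not interior to the set where \<psi> fails.\<close>
    from that M(5) have "y \<in> Top M closure_of V" by blast
    then show ?thesis by (fastforce simp: interior_of_def closure_of_def)
  qed
  then show "sat M x U V \<phi>" using M by (intro soundness[OF assms]) (auto simp: wF_def)
qed

section \<open>Entailment and maximal consistent sets\<close>

text \<open>Necessitation acts only on theorems, inside \<open>Thm\<close>, never on hypotheses;
  this is what makes the deduction theorem provable by propositional steps.\<close>

inductive entails :: "'p fm set \<Rightarrow> 'p fm set \<Rightarrow> 'p fm \<Rightarrow> bool" for A S where
  Hyp: "\<phi> \<in> S \<Longrightarrow> entails A S \<phi>"
| Thm: "EL A \<phi> \<Longrightarrow> entails A S \<phi>"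
| Detach: "entails A S (\<phi> \<^bold>\<longrightarrow> \<psi>) \<Longrightarrow> entails A S \<phi> \<Longrightarrow> entails A S \<psi>"

lemma entails_taut: "(\<And>g. prop_eval g \<phi>) \<Longrightarrow> entails A S \<phi>"
  by (simp add: entails.Thm EL.Taut tautology_def)

text \<open>This and the two-premise version replace Hilbert-style propositional derivations by
  truth-table arguments.\<close>

lemma entails_consequence:
  assumes "entails A S \<phi>" and "\<And>g. prop_eval g \<phi> \<Longrightarrow> prop_eval g \<psi>"
  shows "entails A S \<psi>"
  by (rule entails.Detach[OF entails_taut assms(1)]) (use assms(2) in auto)

lemma entails_consequence2:
  assumes "entails A S \<phi>" "entails A S \<psi>"
    and "\<And>g. \<lbrakk>prop_eval g \<phi>; prop_eval g \<psi>\<rbrakk> \<Longrightarrow> prop_eval g \<chi>"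
  shows "entails A S \<chi>"
  by (rule entails.Detach[OF entails.Detach[OF entails_taut assms(1)] assms(2)])
    (use assms(3) in auto)

lemma entails_mono: "entails A S \<phi> \<Longrightarrow> S \<subseteq> T \<Longrightarrow> entails A T \<phi>"
proof (induction rule: entails.induct)
  case (Detach \<phi> \<psi>)
  then show ?case by (blast intro: entails.Detach)
qed (auto intro: entails.Hyp entails.Thm)

lemma entails_empty: "entails A {} \<phi> \<Longrightarrow> EL A \<phi>"
proof (induction rule: entails.induct)
  case (Detach \<phi> \<psi>)
  from Detach.IH show ?case by (rule EL.MP)
qed auto

lemma deduction:
  "entails A (insert \<psi> S) \<phi> \<Longrightarrow> entails A S (\<psi> \<^bold>\<longrightarrow> \<phi>)"
proof (induction rule: entails.induct)
  case (Hyp \<phi>)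
  then show ?case
    by (cases "\<phi> = \<psi>") (auto intro: entails_taut entails_consequence[OF entails.Hyp])
next
  case (Thm \<phi>)
  then show ?case by (auto intro: entails_consequence[OF entails.Thm])
next
  case (Detach \<phi> \<chi>)
  then show ?case by (auto elim: entails_consequence2)
qed

lemma entails_finite:
  "entails A S \<phi> \<Longrightarrow> \<exists>F. finite F \<and> F \<subseteq> S \<and> entails A F \<phi>"
proof (induction rule: entails.induct)
  case (Hyp \<phi>)
  then show ?case by (intro exI[of _ "{\<phi>}"]) (auto intro: entails.Hyp)
next
  case (Thm \<phi>)
  then show ?case by (intro exI[of _ "{}"]) (auto intro: entails.Thm)
next
  case (Detach \<phi> \<psi>)
  then obtain F G where "finite F" "F \<subseteq> S" "entails A F (\<phi> \<^bold>\<longrightarrow> \<psi>)"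
    "finite G" "G \<subseteq> S" "entails A G \<phi>" by blast
  then show ?case
    by (intro exI[of _ "F \<union> G"]) (auto intro: entails.Detach entails_mono)
qed

text \<open>The modality m can be prefixed to a whole derivation: necessitation handles theorems and
  the K scheme handles each detachment.\<close>

lemma entails_normal:
  assumes "entails A {\<psi>. m \<psi> \<in> \<Gamma>} \<phi>"
    and K: "\<And>\<phi> \<psi>. EL A (m (\<phi> \<^bold>\<longrightarrow> \<psi>) \<^bold>\<longrightarrow> (m \<phi> \<^bold>\<longrightarrow> m \<psi>))"
    and nec: "\<And>\<phi>. EL A \<phi> \<Longrightarrow> EL A (m \<phi>)"
  shows "entails A \<Gamma> (m \<phi>)"
  using assms(1)
proof (induction rule: entails.induct)
  case (Hyp \<phi>)
  then show ?case by (simp add: entails.Hyp)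
next
  case (Thm \<phi>)
  then show ?case by (intro entails.Thm nec)
next
  case (Detach \<phi> \<psi>)
  then show ?case using entails.Detach[OF entails.Detach[OF entails.Thm[OF K]]] by blast
qed

section \<open>Maximal consistent sets\<close>

text \<open>The two directions of the negation clause express consistency and maximality.\<close>

definition mcs :: "'p fm set \<Rightarrow> 'p fm set \<Rightarrow> bool" where
  "mcs A \<Gamma> \<longleftrightarrow> (\<forall>\<phi>. entails A \<Gamma> \<phi> \<longrightarrow> \<phi> \<in> \<Gamma>) \<and> (\<forall>\<phi>. Neg \<phi> \<in> \<Gamma> \<longleftrightarrow> \<phi> \<notin> \<Gamma>)"

lemma mcs_entails: "mcs A \<Gamma> \<Longrightarrow> entails A \<Gamma> \<phi> \<Longrightarrow> \<phi> \<in> \<Gamma>"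
  by (simp add: mcs_def)

lemma mcs_Neg: "mcs A \<Gamma> \<Longrightarrow> Neg \<phi> \<in> \<Gamma> \<longleftrightarrow> \<phi> \<notin> \<Gamma>"
  by (simp add: mcs_def)

lemma mcs_Con: "mcs A \<Gamma> \<Longrightarrow> Con \<phi> \<psi> \<in> \<Gamma> \<longleftrightarrow> \<phi> \<in> \<Gamma> \<and> \<psi> \<in> \<Gamma>"
proof (intro iffI conjI)
  assume \<Gamma>: "mcs A \<Gamma>"
  show "\<phi> \<in> \<Gamma>" "\<psi> \<in> \<Gamma>" if "Con \<phi> \<psi> \<in> \<Gamma>"
    by (rule mcs_entails[OF \<Gamma> entails_consequence[OF entails.Hyp[OF that]]]; simp)+
  show "Con \<phi> \<psi> \<in> \<Gamma>" if "\<phi> \<in> \<Gamma> \<and> \<psi> \<in> \<Gamma>"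
    by (rule mcs_entails[OF \<Gamma> entails_consequence2[of A \<Gamma> \<phi> \<psi>]])
      (use that in \<open>simp_all add: entails.Hyp\<close>)
qed

lemma mcs_step: "mcs A \<Gamma> \<Longrightarrow> EL A (\<phi> \<^bold>\<longrightarrow> \<psi>) \<Longrightarrow> \<phi> \<in> \<Gamma> \<Longrightarrow> \<psi> \<in> \<Gamma>"
  by (erule mcs_entails, rule entails.Detach[OF entails.Thm entails.Hyp])

text \<open>Maximality is taken among the sets that do not entail \<open>\<phi>\<close>, so no falsum formula is needed.\<close>

lemma lindenbaum:
  assumes "\<not> entails A S \<phi>"
  obtains \<Gamma> where "mcs A \<Gamma>" "S \<subseteq> \<Gamma>" "\<phi> \<notin> \<Gamma>"
proof -
  let ?F = "{T. S \<subseteq> T \<and> \<not> entails A T \<phi>}"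
  have "\<exists>M\<in>?F. \<forall>T\<in>?F. M \<subseteq> T \<longrightarrow> T = M"
  proof (rule subset_Zorn_nonempty)
    show "?F \<noteq> {}" using assms by blast
  next
    fix C assume C: "C \<noteq> {}" "subset.chain ?F C"
    have "\<not> entails A (\<Union>C) \<phi>"
    proof
      assume "entails A (\<Union>C) \<phi>"
      from entails_finite[OF this] obtain F
        where F: "finite F" "F \<subseteq> \<Union>C" "entails A F \<phi>" by blast
      \<comment> \<open>The finitely many premises used already lie in one member of the
        chain.\<close>
      obtain T where "T \<in> C" "F \<subseteq> T"
        using finite_subset_Union_chain[OF F(1,2) C] by blast
      moreover have "C \<subseteq> ?F" using C(2) by (simp add: subset_chain_def)
      ultimately show False using entails_mono[OF F(3)] by blast
    qed
    moreover have "S \<subseteq> \<Union>C" using C unfolding subset_chain_def by blast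
    ultimately show "\<Union>C \<in> ?F" by simp
  qed
  then obtain \<Gamma> where S: "S \<subseteq> \<Gamma>" and \<Gamma>: "\<not> entails A \<Gamma> \<phi>"
    and max: "\<forall>T\<in>?F. \<Gamma> \<subseteq> T \<longrightarrow> T = \<Gamma>" by auto
  \<comment> \<open>By maximality, adding any formula outside \<Gamma> makes \<phi>
    derivable.\<close>
  have mem: "entails A \<Gamma> (\<psi> \<^bold>\<longrightarrow> \<phi>)" if "\<psi> \<notin> \<Gamma>" for \<psi>
  proof (rule deduction, rule ccontr)
    assume "\<not> entails A (insert \<psi> \<Gamma>) \<phi>"
    with S have "insert \<psi> \<Gamma> \<in> ?F" by blast
    with max that show False by blast
  qed
  have "mcs A \<Gamma>"
    unfolding mcs_def
  proof (intro conjI allI impI iffI notI)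
    fix \<psi> assume "entails A \<Gamma> \<psi>"
    then show "\<psi> \<in> \<Gamma>" using entails.Detach[OF mem] \<Gamma> by blast
  next
    fix \<psi> assume "Neg \<psi> \<in> \<Gamma>" "\<psi> \<in> \<Gamma>"
    then have "entails A \<Gamma> \<phi>"
      by (rule entails_consequence2[OF entails.Hyp entails.Hyp]) simp
    with \<Gamma> show False ..
  next
    fix \<psi> assume "\<psi> \<notin> \<Gamma>"
    show "Neg \<psi> \<in> \<Gamma>"
    proof (rule ccontr)
      assume "Neg \<psi> \<notin> \<Gamma>"
      \<comment> \<open>Both \<psi> and its negation imply \<phi> over \<Gamma>, so \<phi> follows
        by cases.\<close>
      then have "entails A \<Gamma> \<phi>"
        by (rule entails_consequence2[OF mem[OF \<open>\<psi> \<notin> \<Gamma>\<close>] mem]) auto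
      with \<Gamma> show False ..
    qed
  qed
  moreover have "\<phi> \<notin> \<Gamma>" using \<Gamma> entails.Hyp by blast
  ultimately show thesis using that S by blast
qed

text \<open>If the bodies of the m-formulas in \<Gamma> entailed \<phi>, normality would put
  \<open>m \<phi>\<close> into \<Gamma>. This is the existence lemma for \<open>Know\<close>,
  \<open>Box\<close> and \<open>Bel\<close> alike.\<close>

lemma mcs_witness:
  assumes "mcs A \<Gamma>" "m \<phi> \<notin> \<Gamma>"
    and "\<And>\<phi> \<psi>. EL A (m (\<phi> \<^bold>\<longrightarrow> \<psi>) \<^bold>\<longrightarrow> (m \<phi> \<^bold>\<longrightarrow> m \<psi>))"
    and "\<And>\<phi>. EL A \<phi> \<Longrightarrow> EL A (m \<phi>)"
  obtains \<Delta> where "mcs A \<Delta>" "{\<psi>. m \<psi> \<in> \<Gamma>} \<subseteq> \<Delta>" "\<phi> \<notin> \<Delta>"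
proof -
  have "\<not> entails A {\<psi>. m \<psi> \<in> \<Gamma>} \<phi>"
    using entails_normal[of A m] mcs_entails[OF assms(1)] assms(2-4) by blast
  then show thesis using that by (rule lindenbaum)
qed

lemma Nec_Bel: "EL A \<phi> \<Longrightarrow> EL A (Bel \<phi>)"
  by (rule EL.MP[OF EL.KB EL.Nec_Know])

section \<open>The canonical model\<close>

definition cluster :: "'p fm set \<Rightarrow> 'p fm set \<Rightarrow> 'p fm set set" where
  "cluster A \<Gamma> = {\<Delta>. mcs A \<Delta> \<and> (\<forall>\<phi>. Know \<phi> \<in> \<Delta> \<longleftrightarrow> Know \<phi> \<in> \<Gamma>)}"

definition believed :: "'p fm set \<Rightarrow> 'p fm set \<Rightarrow> 'p fm set set" where
  "believed A \<Gamma> = {\<Delta> \<in> cluster A \<Gamma>. {\<phi>. Bel \<phi> \<in> \<Gamma>} \<subseteq> \<Delta>}"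

text \<open>This is the Alexandrov topology of the canonical \<open>Box\<close> relation restricted
  to the cluster.\<close>

definition canonical_top :: "'p fm set \<Rightarrow> 'p fm set \<Rightarrow> 'p fm set topology" where
  "canonical_top A \<Gamma> = topology (\<lambda>S. S \<subseteq> cluster A \<Gamma> \<and>
     (\<forall>\<Delta>\<in>S. \<forall>\<Theta>\<in>cluster A \<Gamma>. {\<phi>. Box \<phi> \<in> \<Delta>} \<subseteq> \<Theta> \<longrightarrow> \<Theta> \<in> S))"

definition canonical :: "'p fm set \<Rightarrow> 'p fm set \<Rightarrow> ('p fm set, 'p) model" where
  "canonical A \<Gamma> = \<lparr>Top = canonical_top A \<Gamma>, Val = \<lambda>p. {\<Delta> \<in> cluster A \<Gamma>. Pro p \<in> \<Delta>}\<rparr>"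

text \<open>Sets closed under a relation are stable under unions and intersections, so the predicate
  passed to \<open>topology\<close> really is a topology.\<close>

lemma openin_canonical:
  "openin (canonical_top A \<Gamma>) S \<longleftrightarrow> S \<subseteq> cluster A \<Gamma> \<and>
     (\<forall>\<Delta>\<in>S. \<forall>\<Theta>\<in>cluster A \<Gamma>. {\<phi>. Box \<phi> \<in> \<Delta>} \<subseteq> \<Theta> \<longrightarrow> \<Theta> \<in> S)"
proof -
  have "istopology (\<lambda>S. S \<subseteq> cluster A \<Gamma> \<and>
     (\<forall>\<Delta>\<in>S. \<forall>\<Theta>\<in>cluster A \<Gamma>. {\<phi>. Box \<phi> \<in> \<Delta>} \<subseteq> \<Theta> \<longrightarrow> \<Theta> \<in> S))"
    unfolding istopology_def by blast
  then show ?thesis by (simp add: canonical_top_def topology_inverse')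
qed

lemma topspace_canonical: "topspace (canonical_top A \<Gamma>) = cluster A \<Gamma>"
  unfolding topspace_def openin_canonical by blast

lemma cluster_mcs: "\<Delta> \<in> cluster A \<Gamma> \<Longrightarrow> mcs A \<Delta>"
  by (simp add: cluster_def)

lemma cluster_eq: "\<Delta> \<in> cluster A \<Gamma> \<Longrightarrow> cluster A \<Delta> = cluster A \<Gamma>"
  by (auto simp: cluster_def)

text \<open>The S5 axioms upgrade a one-sided inclusion to agreement on all \<open>Know\<close>
  formulas: axiom 4 carries them forward, axiom 5 carries their negations forward.\<close>

lemma cluster_Know:
  assumes "mcs A \<Gamma>" "mcs A \<Delta>" "{\<phi>. Know \<phi> \<in> \<Gamma>} \<subseteq> \<Delta>"
  shows "\<Delta> \<in> cluster A \<Gamma>"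
proof -
  have "Know \<phi> \<in> \<Delta> \<longleftrightarrow> Know \<phi> \<in> \<Gamma>" for \<phi>
  proof
    assume "Know \<phi> \<in> \<Gamma>"
    then show "Know \<phi> \<in> \<Delta>" using mcs_step[OF assms(1) EL.Four_Know] assms(3) by blast
  next
    assume "Know \<phi> \<in> \<Delta>"
    show "Know \<phi> \<in> \<Gamma>"
    proof (rule ccontr)
      assume "Know \<phi> \<notin> \<Gamma>"
      then have "Neg (Know \<phi>) \<in> \<Delta>"
        using mcs_step[OF assms(1) EL.Five_Know] mcs_Neg[OF assms(1)] assms(3) by blast
      with \<open>Know \<phi> \<in> \<Delta>\<close> show False using mcs_Neg[OF assms(2)] by blast
    qed
  qed
  with assms(2) show ?thesis by (simp add: cluster_def)
qed

text \<open>By KI every \<open>Box\<close> successor is also a \<open>Know\<close> successor, so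
  confining the space to one cluster loses no \<open>Box\<close> successor.\<close>

lemma cluster_Box:
  assumes "mcs A \<Gamma>" "mcs A \<Delta>" "{\<phi>. Box \<phi> \<in> \<Gamma>} \<subseteq> \<Delta>"
  shows "\<Delta> \<in> cluster A \<Gamma>"
  using assms(3) mcs_step[OF assms(1) EL.KI] by (intro cluster_Know assms(1,2)) blast

lemma believed_Bel:
  assumes "mcs A \<Gamma>" "mcs A \<Delta>" "{\<phi>. Bel \<phi> \<in> \<Gamma>} \<subseteq> \<Delta>"
  shows "\<Delta> \<in> believed A \<Gamma>"
  using assms(3) mcs_step[OF assms(1) EL.KB] unfolding believed_def
  by (blast intro: cluster_Know assms(1,2))

text \<open>By sPI and T, \<open>Bel \<phi>\<close> and \<open>Know (Bel \<phi>)\<close> belong to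
  the same maximal consistent sets, and the latter is constant on a cluster.\<close>

lemma cluster_same_Bel:
  assumes "mcs A \<Gamma>" "\<Delta> \<in> cluster A \<Gamma>"
  shows "Bel \<phi> \<in> \<Delta> \<longleftrightarrow> Bel \<phi> \<in> \<Gamma>"
proof -
  have "Know (Bel \<phi>) \<in> \<Delta> \<longleftrightarrow> Know (Bel \<phi>) \<in> \<Gamma>" using assms(2) by (simp add: cluster_def)
  then show ?thesis
    using mcs_step[OF assms(1) EL.sPI] mcs_step[OF assms(1) EL.T_Know]
      mcs_step[OF cluster_mcs[OF assms(2)] EL.sPI] mcs_step[OF cluster_mcs[OF assms(2)] EL.T_Know]
    by blast
qed

text \<open>If \<phi> is believed, RB puts \<open>Box \<phi>\<close> into every point of the set, so
  \<phi> persists to all \<open>Box\<close> successors.\<close>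

lemma openin_believed:
  assumes "mcs A \<Gamma>" shows "openin (canonical_top A \<Gamma>) (believed A \<Gamma>)"
  using mcs_step[OF assms EL.RB] unfolding openin_canonical believed_def by blast

text \<open>The \<open>Box\<close> successors of \<Delta> form its least open neighbourhood: T puts
  \<Delta> among them and axiom 4 makes them an open set.\<close>

lemma interior_canonical:
  assumes "\<Delta> \<in> cluster A \<Gamma>"
  shows "\<Delta> \<in> canonical_top A \<Gamma> interior_of S \<longleftrightarrow>
    (\<forall>\<Theta>\<in>cluster A \<Gamma>. {\<phi>. Box \<phi> \<in> \<Delta>} \<subseteq> \<Theta> \<longrightarrow> \<Theta> \<in> S)"
proof
  assume "\<Delta> \<in> canonical_top A \<Gamma> interior_of S"
  then show "\<forall>\<Theta>\<in>cluster A \<Gamma>. {\<phi>. Box \<phi> \<in> \<Delta>} \<subseteq> \<Theta> \<longrightarrow> \<Theta> \<in> S"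
    unfolding interior_of_def openin_canonical by blast
next
  let ?R = "{\<Theta> \<in> cluster A \<Gamma>. {\<phi>. Box \<phi> \<in> \<Delta>} \<subseteq> \<Theta>}"
  assume "\<forall>\<Theta>\<in>cluster A \<Gamma>. {\<phi>. Box \<phi> \<in> \<Delta>} \<subseteq> \<Theta> \<longrightarrow> \<Theta> \<in> S"
  then have "?R \<subseteq> S" by blast
  moreover have "\<Delta> \<in> ?R"
    using assms mcs_step[OF cluster_mcs[OF assms] EL.T_Box] by blast
  moreover have "openin (canonical_top A \<Gamma>) ?R"
    using mcs_step[OF cluster_mcs[OF assms] EL.Four_Box] unfolding openin_canonical by blast
  ultimately show "\<Delta> \<in> canonical_top A \<Gamma> interior_of S"
    unfolding interior_of_def by blast
qed

section \<open>Truth lemma and countermodels\<close>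

lemma truth:
  assumes \<Gamma>: "mcs A \<Gamma>" and "\<Delta> \<in> cluster A \<Gamma>"
  shows "sat (canonical A \<Gamma>) \<Delta> (cluster A \<Gamma>) (believed A \<Gamma>) \<phi> \<longleftrightarrow> \<phi> \<in> \<Delta>"
  using assms(2)
proof (induction \<phi> arbitrary: \<Delta>)
  case (Pro p)
  then show ?case by (simp add: canonical_def)
next
  case (Neg \<phi>)
  then show ?case by (simp add: mcs_Neg[OF cluster_mcs[OF Neg.prems]])
next
  case (Con \<phi> \<psi>)
  then show ?case by (simp add: mcs_Con[OF cluster_mcs[OF Con.prems]])
next
  case (Know \<phi>)
  note \<Delta> = cluster_mcs[OF Know.prems]
  have "(\<forall>\<Theta>\<in>cluster A \<Gamma>. \<phi> \<in> \<Theta>) \<longleftrightarrow> Know \<phi> \<in> \<Delta>"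
  proof
    assume all: "\<forall>\<Theta>\<in>cluster A \<Gamma>. \<phi> \<in> \<Theta>"
    show "Know \<phi> \<in> \<Delta>"
    proof (rule ccontr)
      assume "Know \<phi> \<notin> \<Delta>"
      from mcs_witness[of A \<Delta> Know, OF \<Delta> this EL.K_Know EL.Nec_Know] obtain \<Theta>
        where "mcs A \<Theta>" "{\<psi>. Know \<psi> \<in> \<Delta>} \<subseteq> \<Theta>" "\<phi> \<notin> \<Theta>" by blast
      with all show False using cluster_Know[OF \<Delta>] cluster_eq[OF Know.prems] by blast
    qed
  next
    assume "Know \<phi> \<in> \<Delta>"
    then have "Know \<phi> \<in> \<Theta>" if "\<Theta> \<in> cluster A \<Gamma>" for \<Theta>
      using that Know.prems by (simp add: cluster_def)
    then show "\<forall>\<Theta>\<in>cluster A \<Gamma>. \<phi> \<in> \<Theta>" using mcs_step[OF cluster_mcs EL.T_Know] by blast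
  qed
  then show ?case using Know.IH by auto
next
  case (Box \<phi>)
  note \<Delta> = cluster_mcs[OF Box.prems]
  have "(\<forall>\<Theta>\<in>cluster A \<Gamma>. {\<psi>. Box \<psi> \<in> \<Delta>} \<subseteq> \<Theta> \<longrightarrow> \<phi> \<in> \<Theta>) \<longleftrightarrow> Box \<phi> \<in> \<Delta>"
  proof
    assume all: "\<forall>\<Theta>\<in>cluster A \<Gamma>. {\<psi>. Box \<psi> \<in> \<Delta>} \<subseteq> \<Theta> \<longrightarrow> \<phi> \<in> \<Theta>"
    show "Box \<phi> \<in> \<Delta>"
    proof (rule ccontr)
      assume "Box \<phi> \<notin> \<Delta>"
      from mcs_witness[of A \<Delta> Box, OF \<Delta> this EL.K_Box EL.Nec_Box] obtain \<Theta>
        where "mcs A \<Theta>" "{\<psi>. Box \<psi> \<in> \<Delta>} \<subseteq> \<Theta>" "\<phi> \<notin> \<Theta>" by blast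
      with all show False using cluster_Box[OF \<Delta>] cluster_eq[OF Box.prems] by blast
    qed
  qed blast
  then show ?case using Box.IH by (auto simp: canonical_def interior_canonical[OF Box.prems])
next
  case (Bel \<phi>)
  \<comment> \<open>The argument runs at \<Gamma>, from which the set V is built;
    \<open>cluster_same_Bel\<close> then transfers the result to \<Delta>.\<close>
  have "(\<forall>\<Theta>\<in>believed A \<Gamma>. \<phi> \<in> \<Theta>) \<longleftrightarrow> Bel \<phi> \<in> \<Gamma>"
  proof
    assume all: "\<forall>\<Theta>\<in>believed A \<Gamma>. \<phi> \<in> \<Theta>"
    show "Bel \<phi> \<in> \<Gamma>"
    proof (rule ccontr)
      assume "Bel \<phi> \<notin> \<Gamma>"
      from mcs_witness[of A \<Gamma> Bel, OF \<Gamma> this EL.K_Bel Nec_Bel] obtain \<Theta>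
        where "mcs A \<Theta>" "{\<psi>. Bel \<psi> \<in> \<Gamma>} \<subseteq> \<Theta>" "\<phi> \<notin> \<Theta>" by blast
      with all show False using believed_Bel[OF \<Gamma>] by blast
    qed
  qed (auto simp: believed_def)
  moreover have "believed A \<Gamma> \<subseteq> cluster A \<Gamma>" by (auto simp: believed_def)
  ultimately show ?case using Bel.IH by (auto simp: cluster_same_Bel[OF \<Gamma> Bel.prems])
qed

text \<open>A maximal consistent set omitting \<phi> serves both as the index of the model and as
  the point of evaluation, where the truth lemma refutes \<phi>.\<close>

lemma canonical_countermodel:
  assumes "\<not> EL A \<phi>"
  obtains \<Gamma> where "mcs A \<Gamma>" "topo_subset_model (canonical A \<Gamma>)"
    "ed_scenario (canonical A \<Gamma>) \<Gamma> (cluster A \<Gamma>) (believed A \<Gamma>)"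
    "\<not> sat (canonical A \<Gamma>) \<Gamma> (cluster A \<Gamma>) (believed A \<Gamma>) \<phi>"
proof -
  have "\<not> entails A {} \<phi>" using assms by (auto dest: entails_empty)
  then obtain \<Gamma> where \<Gamma>: "mcs A \<Gamma>" "\<phi> \<notin> \<Gamma>" by (rule lindenbaum)
  then have mem: "\<Gamma> \<in> cluster A \<Gamma>" by (simp add: cluster_def)
  have "topo_subset_model (canonical A \<Gamma>)"
    using mem by (auto simp: topo_subset_model_def canonical_def topspace_canonical)
  moreover have "ed_scenario (canonical A \<Gamma>) \<Gamma> (cluster A \<Gamma>) (believed A \<Gamma>)"
    using mem openin_believed[OF \<Gamma>(1)]
    by (auto simp: ed_scenario_def canonical_def openin_canonical believed_def)
  ultimately show thesis using that \<Gamma> truth[OF \<Gamma>(1) mem] by blast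
qed

section \<open>Nonemptiness and density of the believed set\<close>

text \<open>The contribution of T is condensed into one formula \<chi>. For density, S and T hold
  the bodies of \<open>Box\<close> and \<open>Bel\<close> formulas, and the split lets each modality
  be prefixed separately.\<close>

lemma entails_Un:
  assumes "entails A (S \<union> T) \<phi>"
  obtains \<chi> where "entails A T \<chi>" "entails A S (\<chi> \<^bold>\<longrightarrow> \<phi>)"
proof -
  from assms have "\<exists>\<chi>. entails A T \<chi> \<and> entails A S (\<chi> \<^bold>\<longrightarrow> \<phi>)"
  proof (induction rule: entails.induct)
    case (Hyp \<phi>)
    then show ?case
    proof
      assume "\<phi> \<in> S"
      \<comment> \<open>T contributes nothing here, so a tautology serves as \<chi>.\<close>
      then have "entails A S ((\<phi> \<^bold>\<longrightarrow> \<phi>) \<^bold>\<longrightarrow> \<phi>)"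
        by (auto intro: entails_consequence[OF entails.Hyp])
      moreover have "entails A T (\<phi> \<^bold>\<longrightarrow> \<phi>)" by (rule entails_taut) auto
      ultimately show ?thesis by blast
    next
      assume "\<phi> \<in> T"
      moreover have "entails A S (\<phi> \<^bold>\<longrightarrow> \<phi>)" by (rule entails_taut) auto
      ultimately show ?thesis by (blast intro: entails.Hyp)
    qed
  next
    case (Thm \<phi>)
    moreover have "entails A S (\<phi> \<^bold>\<longrightarrow> \<phi>)" by (rule entails_taut) auto
    ultimately show ?case by (blast intro: entails.Thm)
  next
    case (Detach \<phi> \<psi>)
    then obtain \<chi> \<theta> where "entails A T \<chi>" "entails A T \<theta>"
      and S: "entails A S (\<chi> \<^bold>\<longrightarrow> (\<phi> \<^bold>\<longrightarrow> \<psi>))" "entails A S (\<theta> \<^bold>\<longrightarrow> \<phi>)" by blast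
    then have "entails A T (Con \<chi> \<theta>)" by (auto elim: entails_consequence2)
    moreover have "entails A S (Con \<chi> \<theta> \<^bold>\<longrightarrow> \<psi>)"
      by (rule entails_consequence2[OF S]) auto
    ultimately show ?case by blast
  qed
  with that show thesis by blast
qed

text \<open>A tautology is believed, so by D its negation is not; the existence lemma for
  \<open>Bel\<close> then yields a point.\<close>

lemma believed_nonempty:
  assumes \<Gamma>: "mcs D_B \<Gamma>" shows "believed D_B \<Gamma> \<noteq> {}"
proof -
  \<comment> \<open>Any formula would do in place of \<open>undefined\<close>.\<close>
  let ?t = "undefined \<^bold>\<longrightarrow> undefined :: 'a fm"
  have "EL D_B (?t)" by (simp add: EL.Taut tautology_def)
  then have "Bel (?t) \<in> \<Gamma>" using Nec_Bel mcs_entails[OF \<Gamma>] entails.Thm by blast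
  moreover have "EL D_B (Bel (?t) \<^bold>\<longrightarrow> Neg (Bel (Neg (?t))))"
    by (rule EL.Extra) (auto simp: D_B_def)
  ultimately have "Bel (Neg (?t)) \<notin> \<Gamma>" using mcs_step[OF \<Gamma>] mcs_Neg[OF \<Gamma>] by blast
  from mcs_witness[of D_B \<Gamma> Bel, OF \<Gamma> this EL.K_Bel Nec_Bel] obtain \<Theta>
    where "mcs D_B \<Theta>" "{\<psi>. Bel \<psi> \<in> \<Gamma>} \<subseteq> \<Theta>" by blast
  then show ?thesis using believed_Bel[OF \<Gamma>] by blast
qed

text \<open>Every point \<Delta> has a \<open>Box\<close> successor in the believed set, and every
  open set around \<Delta> contains that successor.\<close>

lemma believed_dense:
  assumes \<Gamma>: "mcs wF \<Gamma>"
  shows "cluster wF \<Gamma> \<subseteq> canonical_top wF \<Gamma> closure_of believed wF \<Gamma>"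
proof
  fix \<Delta> assume mem: "\<Delta> \<in> cluster wF \<Gamma>"
  note \<Delta> = cluster_mcs[OF mem]
  let ?S = "{\<psi>. Box \<psi> \<in> \<Delta>}" and ?T = "{\<psi>. Bel \<psi> \<in> \<Gamma>}"
  \<comment> \<open>Otherwise some believed \<chi> is refuted by the \<open>Box\<close> bodies of
    \<Delta>, so \<open>Box (Neg \<chi>)\<close> is in \<Delta>, whereas wF puts
    \<open>Dia \<chi>\<close> there.\<close>
  have "\<not> entails wF (?S \<union> ?T) (Neg (\<phi> \<^bold>\<longrightarrow> \<phi>))" for \<phi>
  proof
    assume "entails wF (?S \<union> ?T) (Neg (\<phi> \<^bold>\<longrightarrow> \<phi>))"
    then obtain \<chi> where T: "entails wF ?T \<chi>" and S: "entails wF ?S (\<chi> \<^bold>\<longrightarrow> Neg (\<phi> \<^bold>\<longrightarrow> \<phi>))"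
      by (rule entails_Un)
    have "Bel \<chi> \<in> \<Delta>"
      using entails_normal[of wF Bel, OF T EL.K_Bel Nec_Bel] mcs_entails[OF \<Gamma>]
        cluster_same_Bel[OF \<Gamma> mem] by blast
    moreover have "EL wF (Bel \<chi> \<^bold>\<longrightarrow> Dia \<chi>)" by (rule EL.Extra) (auto simp: wF_def)
    ultimately have "Dia \<chi> \<in> \<Delta>" using mcs_step[OF \<Delta>] by blast
    moreover have "entails wF ?S (Neg \<chi>)" by (rule entails_consequence[OF S]) auto
    then have "Box (Neg \<chi>) \<in> \<Delta>"
      using entails_normal[of wF Box, OF _ EL.K_Box EL.Nec_Box] mcs_entails[OF \<Delta>] by blast
    ultimately show False using mcs_Neg[OF \<Delta>] by blast
  qed
  then obtain \<Theta> where "mcs wF \<Theta>" "?S \<union> ?T \<subseteq> \<Theta>" by (meson lindenbaum)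
  then have "\<Theta> \<in> believed wF \<Gamma>" "?S \<subseteq> \<Theta>" using believed_Bel[OF \<Gamma>] by auto
  moreover have "\<Theta> \<in> cluster wF \<Gamma>" using \<open>\<Theta> \<in> believed wF \<Gamma>\<close> by (simp add: believed_def)
  ultimately show "\<Delta> \<in> canonical_top wF \<Gamma> closure_of believed wF \<Gamma>"
    using mem unfolding closure_of_def topspace_canonical openin_canonical by blast
qed

section \<open>Completeness\<close>

lemma D_B_complete:
  assumes "valid_consistent TYPE('p fm set) \<phi>" shows "EL D_B (\<phi> :: 'p fm)"
proof (rule ccontr)
  assume "\<not> EL D_B \<phi>"
  then obtain \<Gamma> where \<Gamma>: "mcs D_B \<Gamma>" "topo_subset_model (canonical D_B \<Gamma>)"
    "ed_scenario (canonical D_B \<Gamma>) \<Gamma> (cluster D_B \<Gamma>) (believed D_B \<Gamma>)"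
    "\<not> sat (canonical D_B \<Gamma>) \<Gamma> (cluster D_B \<Gamma>) (believed D_B \<Gamma>) \<phi>"
    by (rule canonical_countermodel)
  then have "consistent_scenario (canonical D_B \<Gamma>) \<Gamma> (cluster D_B \<Gamma>) (believed D_B \<Gamma>)"
    using believed_nonempty[OF \<Gamma>(1)] by (simp add: consistent_scenario_def)
  with \<Gamma> assms show False unfolding valid_consistent_def by blast
qed

lemma wF_complete:
  assumes "valid_dense TYPE('p fm set) \<phi>" shows "EL wF (\<phi> :: 'p fm)"
proof (rule ccontr)
  assume "\<not> EL wF \<phi>"
  then obtain \<Gamma> where \<Gamma>: "mcs wF \<Gamma>" "topo_subset_model (canonical wF \<Gamma>)"
    "ed_scenario (canonical wF \<Gamma>) \<Gamma> (cluster wF \<Gamma>) (believed wF \<Gamma>)"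
    "\<not> sat (canonical wF \<Gamma>) \<Gamma> (cluster wF \<Gamma>) (believed wF \<Gamma>) \<phi>"
    by (rule canonical_countermodel)
  then have "dense_scenario (canonical wF \<Gamma>) \<Gamma> (cluster wF \<Gamma>) (believed wF \<Gamma>)"
    using believed_dense[OF \<Gamma>(1)] by (simp add: dense_scenario_def canonical_def)
  with \<Gamma> assms show False unfolding valid_dense_def by blast
qed

theorem theorem9:
  shows "(\<forall>\<phi> :: ('p :: countable) fm.
        (EL D_B \<phi> \<longleftrightarrow> valid_consistent TYPE('p fm set) \<phi>) \<and>
        (EL D_B \<phi> \<longrightarrow> valid_consistent TYPE('w) \<phi>)) \<and>
    (\<forall>\<phi> :: 'p fm.
        (EL wF \<phi> \<longleftrightarrow> valid_dense TYPE('p fm set) \<phi>) \<and>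
        (EL wF \<phi> \<longrightarrow> valid_dense TYPE('w) \<phi>))"
  by (blast intro: D_B_sound D_B_complete wF_sound wF_complete)

end
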